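(* Let $t,r\ge1$ be integers and let $\mathcal{P}$ be the set of all partitions. Then, as formal power series in $z,s,q$, $$\sum_{\lambda\in\mathcal{P}} z^{\lambda_1}s^{|\lambda|}q^{\lambda_r+\lambda_{t+r}+\lambda_{2t+r}+\cdots}=\frac{1}{(sz;s)_{r-1}}\prod_{n=0}^\infty\frac{1}{(s^{nt+r}q^{n+1}z;s)_t}.$$
   Context: A partition is a weakly decreasing sequence of nonnegative integers $\lambda=(\lambda_1,\lambda_2,\dots)$, eventually zero, with $\lambda_i=0$ beyond the last nonzero part and $|\lambda|=\sum_i\lambda_i$. The $q$-Pochhammer symbol is $(a;s)_m=\prod_{k=0}^{m-1}(1-as^k)$ for integers $m\ge0$. *)

theory Defs
  imports
    "HOL-Analysis.Analysis"
    "HOL-Computational_Algebra.Formal_Power_Series"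
begin

definition partitions :: "(nat \<Rightarrow> nat) set" where
  "partitions = {p. antimono p \<and> eventually (\<lambda>i. p i = 0) sequentially}"

text \<open>
  The entries of a partition are stored from index 0 on, so the mathematical part
  $\lambda_i$ with $i \geq 1$ is \<open>ppart p i\<close>; the index \<open>i = 0\<close> is meaningless.
\<close>

definition ppart :: "(nat \<Rightarrow> nat) \<Rightarrow> nat \<Rightarrow> nat" where
  "ppart p i = p (i - 1)"

definition psize :: "(nat \<Rightarrow> nat) \<Rightarrow> nat" where
  "psize p = (\<Sum>i. ppart p (i + 1))"

definition qpochhammer :: "'a::comm_ring_1 \<Rightarrow> 'a \<Rightarrow> nat \<Rightarrow> 'a" where
  "qpochhammer a s m = (\<Prod>k<m. 1 - a * s ^ k)"

text \<open>
  Formal power series in \<open>z\<close>, \<open>s\<close>, \<open>q\<close> over a field are modelled by the iterated ring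
  $K[[q]][[z]][[s]]$. The indeterminate \<open>s\<close> is outermost because the library topology on
  \<open>fps\<close> is the adic one in the outermost indeterminate, with discrete coefficients: for each
  \<open>n\<close> there are only finitely many partitions of size \<open>n\<close>, so the sum over all partitions
  converges \<open>s\<close>-adically, whereas it would not converge \<open>z\<close>-adically or \<open>q\<close>-adically.
  Convergence in this topology implies convergence of every coefficient of
  $z^a s^b q^c$, so the limit is the usual formal one.
\<close>

type_synonym 'a fps3 = "'a fps fps fps"

definition var_s :: "'a::comm_ring_1 fps3" where
  "var_s = fps_X"

definition var_z :: "'a::comm_ring_1 fps3" where
  "var_z = fps_const fps_X"

definition var_q :: "'a::comm_ring_1 fps3" where
  "var_q = fps_const (fps_const fps_X)"

text \<open>
  The coefficients of the outermost level do not form a field, but the library division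
  still is the inverse in the ring for series whose \<open>s\<close>-constant term is 1.
\<close>

lemma fps3_divide_self:
  fixes f :: "'a::field fps3"
  assumes "fps_nth f 0 = 1"
  shows "(1 / f) * f = 1"
proof -
  have one: "inverse (1 :: 'a fps fps) = 1"
    by (simp add: fps_inverse_one')
  have sd: "subdegree f = 0"
    using assms by (intro subdegree_eq_0) simp
  have "f * inverse f = 1"
    unfolding fps_inverse_def using assms one by (intro fps_right_inverse) simp
  then show ?thesis
    by (simp add: fps_divide_def sd mult.commute)
qed

end

theory Submission
  imports Defs
begin

text \<open>
  Conjugation turns a partition into the sequence of its column multiplicities
  $\lambda_i - \lambda_{i+1}$, and all three statistics are additive in columns: a column of
  height $i$ contributes $z s^i q^{e_i}$, where $e_i$ counts the $n \geq 0$ with $nt + r \leq i$.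
  Splitting the partitions with at most $N + 1$ parts according to whether they contain a column
  of height $N + 1$ gives $G_{N+1} = G_N + z s^{N+1} q^{e_{N+1}} G_{N+1}$ for their generating
  functions, so $G_N \prod_{i \leq N} (1 - z s^i q^{e_i}) = 1$. Grouping the factors with
  $i \geq r$ into blocks of length $t$, on which $e_i$ is constant, and letting
  $N \to \infty$ gives the product formula.
\<close>

section \<open>Partitions with a bounded number of parts\<close>

definition partitions_upto :: "nat \<Rightarrow> (nat \<Rightarrow> nat) set" where
  "partitions_upto N = {p. antimono p \<and> (\<forall>i\<ge>N. p i = 0)}"

text \<open>In the Young diagram this inserts a column of height \<open>N\<close>, that is, a part
  \<open>N\<close> of the conjugate partition.\<close>

definition add_column :: "nat \<Rightarrow> (nat \<Rightarrow> nat) \<Rightarrow> nat \<Rightarrow> nat" where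
  "add_column N p i = p i + of_bool (i < N)"

text \<open>The indeterminate of the series is \<open>s\<close>; the weight \<open>w p\<close> lies
  in the coefficient ring and carries the \<open>z\<close> and \<open>q\<close> statistics. For sets
  of partitions every coefficient is a finite sum.\<close>

definition size_gf :: "((nat \<Rightarrow> nat) \<Rightarrow> 'b::comm_ring_1) \<Rightarrow> (nat \<Rightarrow> nat) set \<Rightarrow> 'b fps" where
  "size_gf w A = Abs_fps (\<lambda>n. \<Sum>p | p \<in> A \<and> psize p = n. w p)"

lemma partitions_upto_subset: "partitions_upto N \<subseteq> partitions"
  by (auto simp: partitions_upto_def partitions_def eventually_sequentially)

lemma partitions_uptoE:
  assumes "p \<in> partitions"
  obtains N where "p \<in> partitions_upto N"
  using assms by (auto simp: partitions_upto_def partitions_def eventually_sequentially)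

lemma psize_partitions_upto:
  assumes "p \<in> partitions_upto N"
  shows "psize p = (\<Sum>i<N. p i)"
  unfolding psize_def ppart_def
  using assms by (subst suminf_finite[of "{..<N}"]) (auto simp: partitions_upto_def)

text \<open>A nonzero entry at index \<open>i\<close> forces \<open>i + 1\<close> entries to be at
  least 1, so \<open>i\<close> is below the size. This bound yields both finiteness and the
  stabilization of coefficients.\<close>

lemma partitions_upto_psize:
  assumes "p \<in> partitions"
  shows "p \<in> partitions_upto (psize p)"
proof -
  obtain N where N: "p \<in> partitions_upto N"
    using assms by (rule partitions_uptoE)
  have anti: "antimono p"
    using assms by (simp add: partitions_def)
  have "p i = 0" if "i \<ge> psize p" for i
  proof (rule ccontr)
    assume "p i \<noteq> 0"
    then have pos: "p j \<ge> 1" if "j \<le> i" for j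
      using antimonoD[OF anti that] by linarith
    have "\<forall>i\<ge>N. p i = 0"
      using N by (simp add: partitions_upto_def)
    with \<open>p i \<noteq> 0\<close> have "i < N"
      by (meson not_le)
    have "Suc i = (\<Sum>j\<le>i. 1)" by simp
    also have "\<dots> \<le> (\<Sum>j\<le>i. p j)"
      using pos by (intro sum_mono) auto
    also have "\<dots> \<le> (\<Sum>j<N. p j)"
      using \<open>i < N\<close> by (intro sum_mono2) auto
    also have "\<dots> = psize p"
      using N by (simp add: psize_partitions_upto)
    finally show False using that by simp
  qed
  with anti show ?thesis by (simp add: partitions_upto_def)
qed

lemma partition_entry_le_psize:
  assumes "p \<in> partitions"
  shows "p i \<le> psize p"
proof (cases "i < psize p")
  case True
  have "p i \<le> (\<Sum>j<psize p. p j)"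
    using True by (intro member_le_sum) auto
  then show ?thesis
    using psize_partitions_upto[OF partitions_upto_psize[OF assms]] by simp
next
  case False
  then show ?thesis
    using partitions_upto_psize[OF assms] by (simp add: partitions_upto_def)
qed

lemma finite_partitions_psize: "finite {p \<in> partitions. psize p = n}"
proof (rule finite_subset)
  show "{p \<in> partitions. psize p = n}
      \<subseteq> {p. \<forall>i. (i \<in> {..<n} \<longrightarrow> p i \<in> {..n}) \<and> (i \<notin> {..<n} \<longrightarrow> p i = 0)}"
  proof (intro subsetI CollectI allI conjI impI)
    fix p i assume "p \<in> {p \<in> partitions. psize p = n}"
    then have p: "p \<in> partitions" "psize p = n" by auto
    show "p i \<in> {..n}"
      using partition_entry_le_psize[OF p(1)] p(2) by simp
    show "p i = 0" if "i \<notin> {..<n}"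
      using partitions_upto_psize[OF p(1)] p(2) that by (simp add: partitions_upto_def)
  qed
qed (intro finite_set_of_finite_funs; simp)

lemma finite_partitions_psize_subset:
  assumes "A \<subseteq> partitions"
  shows "finite {p. p \<in> A \<and> psize p = n}"
  by (rule finite_subset[OF _ finite_partitions_psize[of n]]) (use assms in auto)

section \<open>Adding and removing columns\<close>

lemma add_column_partitions_upto:
  assumes "p \<in> partitions_upto N"
  shows "add_column N p \<in> partitions_upto N"
  using assms by (auto simp: partitions_upto_def add_column_def antimono_def intro!: add_mono)

lemma psize_add_column:
  assumes "p \<in> partitions_upto N"
  shows "psize (add_column N p) = psize p + N"
  by (simp only: psize_partitions_upto[OF assms]
        psize_partitions_upto[OF add_column_partitions_upto[OF assms]] add_column_def sum.distrib)
    simp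

lemma inj_add_column: "inj (add_column N)"
  by (auto simp: inj_def fun_eq_iff add_column_def)

text \<open>The last possible entry \<open>p N\<close> decides: if it vanishes, there are at most
  \<open>N\<close> parts; otherwise monotonicity makes the first \<open>N + 1\<close> entries
  positive, and a column of full height can be removed.\<close>

lemma partitions_upto_Suc:
  "partitions_upto (Suc N) = partitions_upto N \<union> add_column (Suc N) ` partitions_upto (Suc N)"
proof (intro equalityI subsetI)
  fix p assume p: "p \<in> partitions_upto (Suc N)"
  then have anti: "antimono p" by (simp add: partitions_upto_def)
  show "p \<in> partitions_upto N \<union> add_column (Suc N) ` partitions_upto (Suc N)"
  proof (cases "p N = 0")
    case True
    then have "p \<in> partitions_upto N"
      using p by (auto simp: partitions_upto_def) (metis le_antisym not_less_eq_eq)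
    then show ?thesis by simp
  next
    case False
    have pos: "p i \<ge> 1" if "i \<le> N" for i
      using antimonoD[OF anti that] False by linarith
    \<comment> \<open>The subtraction is never truncated: by \<open>pos\<close>, every entry that it
      lowers is at least 1.\<close>
    define p' where "p' i = p i - of_bool (i < Suc N)" for i
    have "antimono p'"
      unfolding antimono_def
    proof (intro allI impI)
      fix i j :: nat assume "i \<le> j"
      then have "p j \<le> p i" using anti by (simp add: antimonoD)
      moreover have "p j = 0" if "j > N"
        using p that by (simp add: partitions_upto_def)
      ultimately show "p' j \<le> p' i"
        using \<open>i \<le> j\<close> by (cases "j \<le> N") (auto simp: p'_def)
    qed
    then have "p' \<in> partitions_upto (Suc N)"
      using p by (auto simp: partitions_upto_def p'_def)
    moreover have "p = add_column (Suc N) p'"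
      using pos by (auto simp: fun_eq_iff add_column_def p'_def)
    ultimately show ?thesis by blast
  qed
next
  fix p assume "p \<in> partitions_upto N \<union> add_column (Suc N) ` partitions_upto (Suc N)"
  then show "p \<in> partitions_upto (Suc N)"
    using add_column_partitions_upto by (auto simp: partitions_upto_def)
qed

lemma partitions_upto_disjoint_add_column:
  "partitions_upto N \<inter> add_column (Suc N) ` A = {}"
  by (auto simp: partitions_upto_def add_column_def)

section \<open>Generating functions for boundedly many parts\<close>

lemma size_gf_partitions_upto_Suc:
  fixes w :: "(nat \<Rightarrow> nat) \<Rightarrow> 'b::comm_ring_1"
  assumes w: "\<And>p. p \<in> partitions_upto (Suc N) \<Longrightarrow> w (add_column (Suc N) p) = c * w p"
  shows "size_gf w (partitions_upto (Suc N)) * (1 - fps_const c * fps_X ^ Suc N)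
           = size_gf w (partitions_upto N)"
proof -
  let ?P = "partitions_upto (Suc N)" and ?Q = "partitions_upto N" and ?a = "add_column (Suc N)"
  \<comment> \<open>Stating the size condition additively makes this set empty for
    \<open>n < Suc N\<close>, where \<open>n - Suc N\<close> would truncate to 0.\<close>
  let ?I = "\<lambda>n. {p. p \<in> ?P \<and> psize p + Suc N = n}"
  have fin: "finite {p. p \<in> partitions_upto M \<and> psize p = n}" for M n
    by (rule finite_partitions_psize_subset[OF partitions_upto_subset])
  have "size_gf w ?P = size_gf w ?Q + fps_const c * fps_X ^ Suc N * size_gf w ?P"
  proof (rule fps_ext)
    fix n
    have split: "{p. p \<in> ?P \<and> psize p = n} = {p. p \<in> ?Q \<and> psize p = n} \<union> ?a ` ?I n"
      using partitions_upto_Suc[of N] psize_add_column by auto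
    have finI: "finite (?I n)"
      by (rule finite_subset[OF _ fin[of "Suc N" "n - Suc N"]]) auto
    have "(\<Sum>p | p \<in> ?P \<and> psize p = n. w p)
        = (\<Sum>p | p \<in> ?Q \<and> psize p = n. w p) + (\<Sum>p\<in>?a ` ?I n. w p)"
      unfolding split using partitions_upto_disjoint_add_column[of N] fin finI
      by (intro sum.union_disjoint) auto
    also have "(\<Sum>p\<in>?a ` ?I n. w p) = (\<Sum>p\<in>?I n. w (?a p))"
      by (subst sum.reindex) (auto intro: inj_on_subset[OF inj_add_column])
    also have "\<dots> = c * (\<Sum>p\<in>?I n. w p)"
      using w by (simp add: sum_distrib_left)
    also have "\<dots> = fps_nth (fps_const c * fps_X ^ Suc N * size_gf w ?P) n"
    proof (cases "n < Suc N")
      case True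
      then have "?I n = {}" by auto
      then show ?thesis
        using True by (simp add: mult.assoc fps_X_power_mult_nth del: power_Suc)
    next
      case False
      then have "?I n = {p. p \<in> ?P \<and> psize p = n - Suc N}" by auto
      then show ?thesis
        using False by (simp add: mult.assoc fps_X_power_mult_nth size_gf_def del: power_Suc)
    qed
    finally show "fps_nth (size_gf w ?P) n
        = fps_nth (size_gf w ?Q + fps_const c * fps_X ^ Suc N * size_gf w ?P) n"
      by (simp add: size_gf_def)
  qed
  then show ?thesis by (simp add: algebra_simps)
qed

lemma size_gf_partitions_upto_0:
  assumes "w (\<lambda>_. 0) = 1"
  shows "size_gf w (partitions_upto 0) = 1"
proof -
  have "partitions_upto 0 = {\<lambda>_. 0}"
    by (auto simp: partitions_upto_def antimono_def)
  moreover have "psize (\<lambda>_. 0) = 0"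
    by (simp add: psize_def ppart_def)
  ultimately have "{p. p \<in> partitions_upto 0 \<and> psize p = n}
      = (if n = 0 then {\<lambda>_. 0} else {})" for n
    by auto
  then show ?thesis
    using assms by (intro fps_ext) (simp add: size_gf_def)
qed

text \<open>Here \<open>c N\<close> is the weight of one column of height \<open>N\<close>, and the
  recursion telescopes. An equation with right-hand side 1 avoids division over a mere commutative
  ring.\<close>

lemma size_gf_partitions_upto:
  fixes w :: "(nat \<Rightarrow> nat) \<Rightarrow> 'b::comm_ring_1"
  assumes "w (\<lambda>_. 0) = 1"
    and "\<And>N p. p \<in> partitions_upto N \<Longrightarrow> N > 0 \<Longrightarrow> w (add_column N p) = c N * w p"
  shows "size_gf w (partitions_upto N) * (\<Prod>i<N. 1 - fps_const (c (Suc i)) * fps_X ^ Suc i) = 1"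
proof (induction N)
  case 0
  show ?case using assms(1) by (simp add: size_gf_partitions_upto_0)
next
  case (Suc N)
  have "size_gf w (partitions_upto (Suc N)) * (1 - fps_const (c (Suc N)) * fps_X ^ Suc N)
      = size_gf w (partitions_upto N)"
    using assms(2) by (intro size_gf_partitions_upto_Suc) simp
  with Suc.IH show ?case
    by (simp add: mult.assoc[symmetric] mult.commute[of "prod _ _"] del: power_Suc)
qed

section \<open>Passage to all partitions\<close>

lemma size_gf_nth_partitions_upto:
  assumes "n \<le> N"
  shows "fps_nth (size_gf w (partitions_upto N)) n = fps_nth (size_gf w partitions) n"
proof -
  have "p \<in> partitions_upto N" if "p \<in> partitions" "psize p = n" for p
    using partitions_upto_psize[OF that(1)] that(2) assms by (auto simp: partitions_upto_def)
  then have "{p. p \<in> partitions_upto N \<and> psize p = n} = {p. p \<in> partitions \<and> psize p = n}"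
    using partitions_upto_subset by auto
  then show ?thesis by (simp add: size_gf_def)
qed

text \<open>The coefficient at \<open>n\<close> is constant as soon as the finite index set contains
  the finitely many partitions of size \<open>n\<close>.\<close>

lemma has_sum_size_gf:
  "((\<lambda>p. fps_const (w p) * fps_X ^ psize p) has_sum size_gf w partitions) partitions"
  unfolding has_sum_def
proof (rule tendsto_fpsI)
  fix n
  let ?A = "{p. p \<in> partitions \<and> psize p = n}"
  have "fps_nth (\<Sum>p\<in>F. fps_const (w p) * fps_X ^ psize p) n = fps_nth (size_gf w partitions) n"
    if F: "finite F" "?A \<subseteq> F" "F \<subseteq> partitions" for F
  proof -
    have "fps_nth (\<Sum>p\<in>F. fps_const (w p) * fps_X ^ psize p) n
        = (\<Sum>p\<in>F. if psize p = n then w p else 0)"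
      by (auto simp: fps_sum_nth fps_X_power_nth intro!: sum.cong)
    also have "\<dots> = (\<Sum>p\<in>?A. w p)"
      using F by (intro sum.mono_neutral_cong_right) auto
    finally show ?thesis by (simp add: size_gf_def)
  qed
  then show "\<forall>\<^sub>F F in finite_subsets_at_top partitions.
      fps_nth (\<Sum>p\<in>F. fps_const (w p) * fps_X ^ psize p) n = fps_nth (size_gf w partitions) n"
    using finite_partitions_psize
    by (intro eventually_finite_subsets_at_top[THEN iffD2] exI[of _ ?A]) auto
qed

section \<open>The exponent of q contributed by a column\<close>

lemma progression_count_eq_0:
  assumes "N < r"
  shows "(\<Sum>n. of_bool (n * t + r \<le> N) :: nat) = 0"
  using assms by (intro suminf_eq_zero_iff[THEN iffD2]) auto

text \<open>Since \<open>k < t\<close>, the inequality says \<open>n * t < (m + 1) * t\<close>, so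
  exactly the indices 0 to \<open>m\<close> count.\<close>

lemma progression_count_block:
  assumes "k < t"
  shows "(\<Sum>n. of_bool (n * t + r \<le> m * t + r + k) :: nat) = m + 1"
proof -
  have "n * t + r \<le> m * t + r + k \<longleftrightarrow> n \<le> m" for n
  proof
    assume "n * t + r \<le> m * t + r + k"
    then have "n * t < Suc m * t" using assms by simp
    then show "n \<le> m" by (metis less_Suc_eq_le mult_less_cancel2)
  next
    assume "n \<le> m"
    then show "n * t + r \<le> m * t + r + k" by (simp add: add_increasing2)
  qed
  then have "(\<Sum>n. of_bool (n * t + r \<le> m * t + r + k) :: nat) = (\<Sum>n. of_bool (n \<le> m))"
    by simp
  also have "\<dots> = (\<Sum>n\<le>m. of_bool (n \<le> m))"
    by (rule suminf_finite) auto
  also have "\<dots> = m + 1" by simp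
  finally show ?thesis .
qed

lemma progression_sum_add_column:
  assumes p: "p \<in> partitions_upto N" and "t \<ge> 1" "r \<ge> 1"
  shows "(\<Sum>n. ppart (add_column N p) (n * t + r))
           = (\<Sum>n. ppart p (n * t + r)) + (\<Sum>n. of_bool (n * t + r \<le> N))"
proof -
  \<comment> \<open>This confines the nonzero terms of both series to \<open>n < N\<close>, so the
    infinite sums may be added termwise.\<close>
  have le: "n \<le> n * t + r - 1" for n
  proof -
    have "n * 1 \<le> n * t" using \<open>t \<ge> 1\<close> by (intro mult_le_mono) auto
    then show ?thesis using \<open>r \<ge> 1\<close> by linarith
  qed
  have "ppart p (n * t + r) = 0" if "n \<ge> N" for n
    using p le[of n] that unfolding partitions_upto_def ppart_def by auto
  then have "summable (\<lambda>n. ppart p (n * t + r))"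
    by (intro summable_finite[of "{..<N}"]) auto
  moreover have "\<not> n * t + r \<le> N" if "n \<ge> N" for n
    using le[of n] that \<open>r \<ge> 1\<close> by linarith
  then have "summable (\<lambda>n. of_bool (n * t + r \<le> N) :: nat)"
    by (intro summable_finite[of "{..<N}"]) auto
  ultimately have "(\<Sum>n. ppart p (n * t + r)) + (\<Sum>n. of_bool (n * t + r \<le> N))
      = (\<Sum>n. ppart p (n * t + r) + of_bool (n * t + r \<le> N))"
    by (rule suminf_add)
  \<comment> \<open>Entries are stored from index 0, and \<open>r \<ge> 1\<close> turns
    \<open>n * t + r - 1 < N\<close> into \<open>n * t + r \<le> N\<close>.\<close>
  moreover have "ppart p (n * t + r) + of_bool (n * t + r \<le> N)
      = ppart (add_column N p) (n * t + r)" for n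
    using \<open>r \<ge> 1\<close> by (auto simp: ppart_def add_column_def)
  ultimately show ?thesis by simp
qed

section \<open>Grouping into blocks and limits of truncations\<close>

lemma prod_lessThan_add_blocks:
  fixes f :: "nat \<Rightarrow> 'b::comm_monoid_mult"
  shows "(\<Prod>i<a + M * t. f i) = (\<Prod>i<a. f i) * (\<Prod>n<M. \<Prod>k<t. f (a + n * t + k))"
proof (induction M)
  case (Suc M)
  have "(\<Prod>i<b + t. f i) = (\<Prod>i<b. f i) * (\<Prod>k<t. f (b + k))" for b
    by (induction t) (simp_all add: mult_ac)
  from this[of "a + M * t"] Suc.IH show ?case
    by (simp add: add_ac mult_ac)
qed simp

lemma tendsto_size_gf_partitions_upto:
  assumes "filterlim h at_top F"
  shows "((\<lambda>M. f * size_gf w (partitions_upto (h M))) \<longlongrightarrow> f * size_gf w partitions) F"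
proof (rule tendsto_fpsI)
  fix n
  have "eventually (\<lambda>M. n \<le> h M) F"
    using assms by (simp add: filterlim_at_top)
  then show "\<forall>\<^sub>F M in F. fps_nth (f * size_gf w (partitions_upto (h M))) n
      = fps_nth (f * size_gf w partitions) n"
    by eventually_elim (auto simp: fps_mult_nth size_gf_nth_partitions_upto intro!: sum.cong)
qed

lemma qpochhammer_nth_0:
  fixes a :: "'b::comm_ring_1 fps"
  assumes "fps_nth a 0 = 0"
  shows "fps_nth (qpochhammer a s m) 0 = 1"
  unfolding qpochhammer_def by (induction m) (simp_all add: assms)

text \<open>Collects \<open>z\<close> and \<open>q\<close> in the coefficient of a power of the
  outermost indeterminate, the form in which \<open>size_gf\<close> handles weights.\<close>

lemma var_monomial:
  "var_z ^ a * var_s ^ b * var_q ^ c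
     = fps_const (fps_X ^ a * fps_const fps_X ^ c) * (fps_X ^ b :: 'a::comm_ring_1 fps3)"
  unfolding var_z_def var_s_def var_q_def
  by (simp only: fps_const_power fps_const_mult[symmetric] mult_ac)

section \<open>Evaluation of the infinite product\<close>

theorem theorem8:
  fixes t r :: nat
  assumes "t \<ge> 1" and "r \<ge> 1"
  shows "convergent_prod
           (\<lambda>n. 1 / qpochhammer (var_s ^ (n * t + r) * var_q ^ (n + 1) * var_z) var_s t
              :: 'a::field fps3)
       \<and> ((\<lambda>p. var_z ^ ppart p 1 * var_s ^ psize p * var_q ^ (\<Sum>n. ppart p (n * t + r)) :: 'a fps3)
           has_sum
             (1 / qpochhammer (var_s * var_z) var_s (r - 1)
               * (\<Prod>n. 1 / qpochhammer (var_s ^ (n * t + r) * var_q ^ (n + 1) * var_z) var_s t)))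
           partitions"
proof -
  define e where "e N = (\<Sum>n. of_bool (n * t + r \<le> N) :: nat)" for N
  \<comment> \<open>In this coefficient ring \<open>fps_X\<close> is \<open>z\<close> and
    \<open>fps_const fps_X\<close> is \<open>q\<close>. A column of positive height raises the first
    part by one, hence the single factor \<open>z\<close>.\<close>
  define c :: "nat \<Rightarrow> 'a fps fps" where "c N = fps_X * fps_const fps_X ^ e N" for N
  define w :: "(nat \<Rightarrow> nat) \<Rightarrow> 'a fps fps" where
    "w p = fps_X ^ ppart p 1 * fps_const fps_X ^ (\<Sum>n. ppart p (n * t + r))" for p
  define G where "G N = size_gf w (partitions_upto N)" for N
  define g where "g = size_gf w partitions"
  define x :: "nat \<Rightarrow> 'a fps3" where "x i = 1 - fps_const (c (Suc i)) * fps_X ^ Suc i" for i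
  define A :: "'a fps3" where "A = qpochhammer (var_s * var_z) var_s (r - 1)"
  define B :: "nat \<Rightarrow> 'a fps3" where
    "B n = qpochhammer (var_s ^ (n * t + r) * var_q ^ (n + 1) * var_z) var_s t" for n

  have w0: "w (\<lambda>_. 0) = 1"
    by (simp add: w_def ppart_def)
  have wcol: "w (add_column N p) = c N * w p" if "p \<in> partitions_upto N" "N > 0" for N p
    using progression_sum_add_column[OF that(1) assms] that(2)
    by (simp add: w_def c_def e_def ppart_def add_column_def power_add mult_ac)
  have G: "G N * (\<Prod>i<N. x i) = 1" for N
    unfolding G_def x_def by (rule size_gf_partitions_upto[OF w0 wcol])

  \<comment> \<open>Columns of height below \<open>r\<close> miss the progression, so their factors
    contain no \<open>q\<close>.\<close>
  have A: "A = (\<Prod>i<r - 1. x i)"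
    unfolding A_def qpochhammer_def
  proof (rule prod.cong)
    fix i assume "i \<in> {..<r - 1}"
    then have "e (Suc i) = 0"
      unfolding e_def by (intro progression_count_eq_0) auto
    then show "1 - var_s * var_z * var_s ^ i = x i"
      using var_monomial[where 'a='a, of 1 "Suc i" 0] by (simp add: x_def c_def mult_ac)
  qed simp
  have B: "B n = (\<Prod>k<t. x (r - 1 + n * t + k))" for n
    unfolding B_def qpochhammer_def
  proof (rule prod.cong)
    fix k assume "k \<in> {..<t}"
    then have e: "e (n * t + r + k) = n + 1"
      unfolding e_def by (intro progression_count_block) simp
    \<comment> \<open>The factor \<open>x i\<close> belongs to columns of height
      \<open>i + 1\<close>, so the blocks start at index \<open>r - 1\<close>.\<close>
    have Suc: "Suc (r - 1 + n * t + k) = n * t + r + k"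
      using \<open>r \<ge> 1\<close> by simp
    show "1 - var_s ^ (n * t + r) * var_q ^ (n + 1) * var_z * var_s ^ k = x (r - 1 + n * t + k)"
      unfolding x_def Suc c_def e
      using var_monomial[where 'a='a, of 1 "n * t + r + k" "n + 1"]
      by (simp only: power_add power_one_right mult_ac)
  qed simp

  have A0: "fps_nth A 0 = 1"
    unfolding A_def by (intro qpochhammer_nth_0) (simp add: var_s_def)
  have B0: "fps_nth (B n) 0 = 1" for n
    unfolding B_def using \<open>r \<ge> 1\<close>
    by (intro qpochhammer_nth_0) (simp add: var_s_def power_0_left)

  \<comment> \<open>Both sides are inverse to the product of the \<open>B n\<close> with
    \<open>n < M\<close>, and inverses in a commutative ring are unique.\<close>
  have partial: "(\<Prod>n<M. 1 / B n) = A * G (r - 1 + M * t)" for M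
  proof -
    have "(\<Prod>n<M. 1 / B n) * (\<Prod>n<M. B n) = 1"
      using fps3_divide_self[OF B0] by (simp flip: prod.distrib)
    moreover have "G (r - 1 + M * t) * (A * (\<Prod>n<M. B n)) = 1"
      using G[of "r - 1 + M * t"] by (simp only: prod_lessThan_add_blocks A B)
    ultimately show ?thesis
      by algebra
  qed
  \<comment> \<open>\<open>Suc M\<close> appears because the partial products of an infinite product
    run over \<open>n \<le> M\<close>.\<close>
  have "filterlim (\<lambda>M. r - 1 + Suc M * t) at_top sequentially"
  proof (rule filterlim_at_top_mono[OF filterlim_ident])
    have "M * 1 \<le> M * t" for M
      using \<open>t \<ge> 1\<close> by (intro mult_le_mono) auto
    then show "\<forall>\<^sub>F M in sequentially. M \<le> r - 1 + Suc M * t"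
      by (intro always_eventually) (simp add: trans_le_add2)
  qed
  then have "(\<lambda>M. A * G (r - 1 + Suc M * t)) \<longlonglongrightarrow> A * g"
    unfolding G_def g_def by (rule tendsto_size_gf_partitions_upto)
  then have lim: "(\<lambda>M. \<Prod>n\<le>M. 1 / B n) \<longlonglongrightarrow> A * g"
    by (simp only: partial flip: lessThan_Suc_atMost)
  \<comment> \<open>An infinite product in the sense of \<open>raw_has_prod\<close> must have a
    nonzero limit; constant term 1 ensures this.\<close>
  have "fps_nth g 0 = 1"
    using size_gf_nth_partitions_upto[of 0 0 w] size_gf_partitions_upto_0[of w, OF w0]
    by (simp add: g_def)
  then have "fps_nth (A * g) 0 = 1"
    using A0 by simp
  then have "A * g \<noteq> 0" by auto
  with lim have raw: "raw_has_prod (\<lambda>n. 1 / B n) 0 (A * g)"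
    by (simp add: raw_has_prod_def)
  then have "(\<Prod>n. 1 / B n) = A * g"
    by (intro has_prod_unique[symmetric]) (simp add: has_prod_def)
  then have "1 / A * (\<Prod>n. 1 / B n) = g"
    using fps3_divide_self[OF A0] by (simp add: mult.assoc[symmetric])
  moreover have "var_z ^ ppart p 1 * var_s ^ psize p * var_q ^ (\<Sum>n. ppart p (n * t + r))
      = fps_const (w p) * fps_X ^ psize p" for p
    unfolding w_def by (rule var_monomial)
  moreover have "((\<lambda>p. fps_const (w p) * fps_X ^ psize p) has_sum g) partitions"
    unfolding g_def by (rule has_sum_size_gf)
  moreover have "convergent_prod (\<lambda>n. 1 / B n)"
    using raw by (auto simp: convergent_prod_def)
  ultimately show ?thesis
    by (simp only: A_def B_def simp_thms)
qed

end
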